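(* The problem $S(t_0,x_0)$ (defined in the context, with objective given by a sum plus a supremum term) is a special case of the forward separable problem $H(t_0,x_0)$ (defined in the context).
   Context: Data: $T\in\mathbb{N}$, $t_0\in\{0,\dots,T-1\}$, $x_0\in\mathbb{R}^n$, $X\subset\mathbb{R}^n$, $U\subset\mathbb{R}^p$, $f:\mathbb{R}^n\times\mathbb{R}^p\times\mathbb{N}\to\mathbb{R}^n$; $\mathbf{u}=(u(t_0),\dots,u(T-1))$ with $u(t)\in\mathbb{R}^p$ and $\mathbf{x}=(x(t_0),\dots,x(T))$ with $x(t)\in\mathbb{R}^n$. For all $x$ and $t$ the set $\Gamma_{t,x}=\{u\in U: f[x,u,t]\in X\}$ is assumed nonempty. $S(t_0,x_0)$ is the problem of minimizing over $\mathbf{u},\mathbf{x}$ $$J_{t_0,x_0}(\mathbf{u},\mathbf{x})=\sum_{t=t_0}^{T-1}c_t(x(t),u(t))+c_T(x(T))+\sup_{t_0\le k\le T}d_k(x(k))$$ subject to $x(t_0)=x_0$; $x(t+1)=f[x(t),u(t),t]$ and $u(t)\in U$ for $t=t_0,\dots,T-1$; $x(t)\in X$ for $t=t_0,\dots,T$. Here $c_t:\mathbb{R}^n\times\mathbb{R}^p\to\mathbb{R}$ ($t=t_0,\dots,T-1$), $c_T:\mathbb{R}^n\to\mathbb{R}$ and $d_t:\mathbb{R}^n\to\mathbb{R}$ ($t=t_0,\dots,T$) are given functions. Class $G$: indexed problems $G(t_0,x_0)$ of minimizing an objective $J_{t_0,x_0}(\mathbf{u},\mathbf{x})$ subject to $x(t_0)=x_0$;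 $x(t+1)=f[x(t),u(t),t]$ and $u(t)\in U$ for $t=t_0,\dots,T-1$; $x(t)\in X$ for $t=t_0+1,\dots,T$. Class $P$: the problems of class $G$ whose objective has the form $J_{t_0,x_0}(\mathbf{u},\mathbf{x})=\sum_{t=t_0}^{T-1}c_t(x(t),u(t))+c_T(x(T))$ for given functions $c_t:\mathbb{R}^n\times\mathbb{R}^p\to\mathbb{R}$ and $c_T:\mathbb{R}^n\to\mathbb{R}$. $H(t_0,x_0)$ denotes the class of indexed forward separable problems: those of class $G$, but not of class $P$, whose objective $J_{t_0,x_0}$ is forward separable. A function $J(\mathbf{u},\mathbf{x})$ is forward separable if, for some $q\in\mathbb{N}$, there exist functions $\phi_{t_0}:\mathbb{R}^n\times\mathbb{R}^p\to\mathbb{R}^q$, $\phi_t:\mathbb{R}^n\times\mathbb{R}^p\times\mathbb{R}^q\to\mathbb{R}^q$ for $t=t_0+1,\dots,T-1$, and $\phi_T:\mathbb{R}^n\times\mathbb{R}^q\to\mathbb{R}$ such that $$J(\mathbf{u},\mathbf{x})=\phi_T\big(x(T),\phi_{T-1}[x(T-1),u(T-1),\phi_{T-2}\{\dots,\phi_{t_0+1}\{x(t_0+1),u(t_0+1),\phi_{t_0}\{x(t_0),u(t_0)\}\}\dots\}]\big).$$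
   Formalization: S is shown to lie in H exactly when x_0 is in X and, from some state sequence, the supremum can be raised by changing the state at either of two times; otherwise S is not of class G (x_0 outside X) or is of class P (e.g. constant d_k). Its objective is always forward separable. *)

theory Defs
  imports "HOL-Analysis.Analysis"
begin

text \<open>
  Control sequences $(u(t_0),\dots,u(T-1))$ and state sequences $(x(t_0),\dots,x(T))$ are
  extensional functions on their time ranges, so that a sequence carries no data at other times.
\<close>

definition controls :: "nat \<Rightarrow> nat \<Rightarrow> (nat \<Rightarrow> real ^ 'p) set" where
  "controls T t0 = {t0..<T} \<rightarrow>\<^sub>E UNIV"

definition states :: "nat \<Rightarrow> nat \<Rightarrow> (nat \<Rightarrow> real ^ 'n) set" where
  "states T t0 = {t0..T} \<rightarrow>\<^sub>E UNIV"

text \<open>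
  A minimization problem is its objective together with its feasible set. Only the values of the
  objective on \<^term>\<open>controls T t0\<close> and \<^term>\<open>states T t0\<close> are meaningful.
\<close>

record ('n, 'p) problem =
  objective :: "(nat \<Rightarrow> real ^ ('p::finite)) \<Rightarrow> (nat \<Rightarrow> real ^ ('n::finite)) \<Rightarrow> real"
  feasible :: "((nat \<Rightarrow> real ^ 'p) \<times> (nat \<Rightarrow> real ^ 'n)) set"

definition admissible ::
  "(real ^ 'n) set \<Rightarrow> (real ^ 'p) set \<Rightarrow> (real ^ 'n \<Rightarrow> real ^ 'p \<Rightarrow> nat \<Rightarrow> real ^ 'n)
    \<Rightarrow> nat \<Rightarrow> real ^ 'n \<Rightarrow> (real ^ 'p) set" where
  "admissible X U f t x = {u \<in> U. f x u t \<in> X}"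

definition feasible_G ::
  "nat \<Rightarrow> (real ^ 'n) set \<Rightarrow> (real ^ 'p) set \<Rightarrow> (real ^ 'n \<Rightarrow> real ^ 'p \<Rightarrow> nat \<Rightarrow> real ^ 'n)
    \<Rightarrow> nat \<Rightarrow> real ^ 'n \<Rightarrow> ((nat \<Rightarrow> real ^ 'p) \<times> (nat \<Rightarrow> real ^ 'n)) set" where
  "feasible_G T X U f t0 x0 =
    {(u, x). u \<in> controls T t0 \<and> x \<in> states T t0 \<and> x t0 = x0 \<and>
      (\<forall>t\<in>{t0..<T}. x (Suc t) = f (x t) (u t) t \<and> u t \<in> U) \<and>
      (\<forall>t\<in>{t0+1..T}. x t \<in> X)}"

text \<open>Unlike \<^const>\<open>feasible_G\<close>, the next set also constrains the initial state to \<open>X\<close>.\<close>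

definition feasible_S ::
  "nat \<Rightarrow> (real ^ 'n) set \<Rightarrow> (real ^ 'p) set \<Rightarrow> (real ^ 'n \<Rightarrow> real ^ 'p \<Rightarrow> nat \<Rightarrow> real ^ 'n)
    \<Rightarrow> nat \<Rightarrow> real ^ 'n \<Rightarrow> ((nat \<Rightarrow> real ^ 'p) \<times> (nat \<Rightarrow> real ^ 'n)) set" where
  "feasible_S T X U f t0 x0 =
    {(u, x). u \<in> controls T t0 \<and> x \<in> states T t0 \<and> x t0 = x0 \<and>
      (\<forall>t\<in>{t0..<T}. x (Suc t) = f (x t) (u t) t \<and> u t \<in> U) \<and>
      (\<forall>t\<in>{t0..T}. x t \<in> X)}"

definition problem_S ::
  "nat \<Rightarrow> (real ^ 'n) set \<Rightarrow> (real ^ 'p) set \<Rightarrow> (real ^ 'n \<Rightarrow> real ^ 'p \<Rightarrow> nat \<Rightarrow> real ^ 'n)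
    \<Rightarrow> (nat \<Rightarrow> real ^ 'n \<Rightarrow> real ^ 'p \<Rightarrow> real) \<Rightarrow> (real ^ 'n \<Rightarrow> real) \<Rightarrow> (nat \<Rightarrow> real ^ 'n \<Rightarrow> real)
    \<Rightarrow> nat \<Rightarrow> real ^ 'n \<Rightarrow> ('n, 'p) problem" where
  "problem_S T X U f c cT d t0 x0 =
    \<lparr>objective = (\<lambda>u x. (\<Sum>t=t0..<T. c t (x t) (u t)) + cT (x T) + (SUP k\<in>{t0..T}. d k (x k))),
     feasible = feasible_S T X U f t0 x0\<rparr>"

definition class_G ::
  "nat \<Rightarrow> (real ^ 'n) set \<Rightarrow> (real ^ 'p) set \<Rightarrow> (real ^ 'n \<Rightarrow> real ^ 'p \<Rightarrow> nat \<Rightarrow> real ^ 'n)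
    \<Rightarrow> nat \<Rightarrow> real ^ 'n \<Rightarrow> ('n, 'p) problem set" where
  "class_G T X U f t0 x0 = {P. feasible P = feasible_G T X U f t0 x0}"

definition class_P ::
  "nat \<Rightarrow> (real ^ 'n) set \<Rightarrow> (real ^ 'p) set \<Rightarrow> (real ^ 'n \<Rightarrow> real ^ 'p \<Rightarrow> nat \<Rightarrow> real ^ 'n)
    \<Rightarrow> nat \<Rightarrow> real ^ 'n \<Rightarrow> ('n, 'p) problem set" where
  "class_P T X U f t0 x0 =
    {P \<in> class_G T X U f t0 x0.
      \<exists>(c :: nat \<Rightarrow> real ^ 'n \<Rightarrow> real ^ 'p \<Rightarrow> real) (cT :: real ^ 'n \<Rightarrow> real).
        \<forall>u\<in>controls T t0. \<forall>x\<in>states T t0.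
          objective P u x = (\<Sum>t=t0..<T. c t (x t) (u t)) + cT (x T)}"

text \<open>
  The dimension \<open>q\<close> in the definition of forward separability is existentially quantified, so
  $\mathbb{R}^q$ cannot be a type; it is the following set.
\<close>

definition Rvec :: "nat \<Rightarrow> (nat \<Rightarrow> real) set" where
  "Rvec q = {..<q} \<rightarrow>\<^sub>E UNIV"

text \<open>
  \<open>nested \<phi>0 \<phi> t0 u x k\<close> is
  $\phi_{t_0+k}\{x(t_0+k),u(t_0+k),\phi_{t_0+k-1}\{\dots,\phi_{t_0}\{x(t_0),u(t_0)\}\dots\}\}$.
\<close>

primrec nested ::
  "('x \<Rightarrow> 'u \<Rightarrow> 'z) \<Rightarrow> (nat \<Rightarrow> 'x \<Rightarrow> 'u \<Rightarrow> 'z \<Rightarrow> 'z) \<Rightarrow> nat \<Rightarrow> (nat \<Rightarrow> 'u) \<Rightarrow> (nat \<Rightarrow> 'x) \<Rightarrow> nat \<Rightarrow> 'z"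
where
  "nested \<phi>0 \<phi> t0 u x 0 = \<phi>0 (x t0) (u t0)"
| "nested \<phi>0 \<phi> t0 u x (Suc k) =
     \<phi> (t0 + Suc k) (x (t0 + Suc k)) (u (t0 + Suc k)) (nested \<phi>0 \<phi> t0 u x k)"

definition forward_separable ::
  "nat \<Rightarrow> nat \<Rightarrow> ((nat \<Rightarrow> real ^ 'p) \<Rightarrow> (nat \<Rightarrow> real ^ 'n) \<Rightarrow> real) \<Rightarrow> bool" where
  "forward_separable T t0 J \<longleftrightarrow>
    (\<exists>(q::nat)
      (\<phi>0 :: real ^ 'n \<Rightarrow> real ^ 'p \<Rightarrow> (nat \<Rightarrow> real))
      (\<phi> :: nat \<Rightarrow> real ^ 'n \<Rightarrow> real ^ 'p \<Rightarrow> (nat \<Rightarrow> real) \<Rightarrow> (nat \<Rightarrow> real))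
      (\<phi>T :: real ^ 'n \<Rightarrow> (nat \<Rightarrow> real) \<Rightarrow> real).
        (\<forall>x u. \<phi>0 x u \<in> Rvec q) \<and>
        (\<forall>t\<in>{t0+1..<T}. \<forall>x u. \<forall>z\<in>Rvec q. \<phi> t x u z \<in> Rvec q) \<and>
        (\<forall>u\<in>controls T t0. \<forall>x\<in>states T t0.
          J u x = \<phi>T (x T) (nested \<phi>0 \<phi> t0 u x (T - 1 - t0))))"

definition class_H ::
  "nat \<Rightarrow> (real ^ 'n) set \<Rightarrow> (real ^ 'p) set \<Rightarrow> (real ^ 'n \<Rightarrow> real ^ 'p \<Rightarrow> nat \<Rightarrow> real ^ 'n)
    \<Rightarrow> nat \<Rightarrow> real ^ 'n \<Rightarrow> ('n, 'p) problem set" where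
  "class_H T X U f t0 x0 =
    {P \<in> class_G T X U f t0 x0. P \<notin> class_P T X U f t0 x0 \<and> forward_separable T t0 (objective P)}"

text \<open>
  For some \<open>d\<close> (for instance constant functions) the supremum is itself a sum of functions of the
  individual \<open>x(k)\<close>, and \<^const>\<open>problem_S\<close> then falls into \<^const>\<open>class_P\<close>. The supremum
  is genuine if, starting from some state sequence, it can be increased by changing the state at
  either of two different times.
\<close>

definition genuine_sup :: "nat \<Rightarrow> nat \<Rightarrow> (nat \<Rightarrow> real ^ 'n \<Rightarrow> real) \<Rightarrow> bool" where
  "genuine_sup T t0 d \<longleftrightarrow>
    (\<exists>x\<in>states T t0. \<exists>k\<in>{t0..T}. \<exists>l\<in>{t0..T}. k \<noteq> l \<and>
      (\<exists>y. d k y > (SUP j\<in>{t0..T}. d j (x j))) \<and>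
      (\<exists>z. d l z > (SUP j\<in>{t0..T}. d j (x j))))"

end

theory Submission
  imports Defs
begin

text \<open>
  Write \<open>M x\<close> for the supremum term of the objective. Since the index range is finite, \<open>M x\<close> is a
  maximum, so it can be computed stage by stage: carrying the pair (cost so far, maximum so far)
  from one stage to the next shows that the objective is forward separable with \<open>q = 2\<close>
  (\<open>forward_separable_sum_plus_sup\<close>).

  The problem belongs to the class \<open>G\<close> exactly when \<open>x0 \<in> X\<close>. If \<open>x0 \<in> X\<close>, the two feasible sets
  coincide. If \<open>x0 \<notin> X\<close>, then no pair satisfies the constraints of \<open>S\<close>, whereas those of \<open>G\<close> can
  be met by choosing an admissible control at every stage (\<open>feasible_G_nonempty\<close>).

  It remains to see when the problem lies in the class \<open>P\<close>, which amounts to \<open>M\<close> being a sum of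
  functions of the single states \<open>x k\<close>.
  Suppose that the supremum is genuine: from some \<open>x\<close>, replacing \<open>x k\<close> by \<open>y\<close> and \<open>x l\<close> by \<open>z\<close>
  increases the supremum to \<open>d k y\<close> and \<open>d l z\<close>, respectively, so that making both replacements
  increases it to the larger of the two. For a sum of functions of single states, the increase
  caused by both replacements is the sum of the two separate increases; this would force
  \<open>M x = min (d k y) (d l z)\<close>, but both numbers exceed \<open>M x\<close>
  (\<open>not_additive_if_genuine_sup\<close>).
  Suppose that it is not genuine. Then there is one time \<open>k\<close> such that no change of the state at
  any other time can ever raise the supremum: if two state sequences had different critical
  times, the one with the smaller supremum would have both of them. Hence \<open>M x\<close> depends on \<open>x k\<close>
  alone (\<open>sup_depends_on_one_time\<close>), and it can be absorbed into the cost of stage \<open>k\<close>.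
\<close>

section \<open>The supremum term\<close>

abbreviation sup_term :: "nat \<Rightarrow> nat \<Rightarrow> (nat \<Rightarrow> 'x \<Rightarrow> real) \<Rightarrow> (nat \<Rightarrow> 'x) \<Rightarrow> real" where
  "sup_term t0 T d x \<equiv> (SUP k\<in>{t0..T}. d k (x k))"

lemma sup_term_upper: "k \<in> {t0..T} \<Longrightarrow> d k (x k) \<le> sup_term t0 T d x"
  by (rule cSUP_upper) auto

lemma sup_term_attained:
  assumes "t0 \<le> T"
  obtains k where "k \<in> {t0..T}" "sup_term t0 T d x = d k (x k)"
proof -
  have "sup_term t0 T d x = Max ((\<lambda>k. d k (x k)) ` {t0..T})"
    using assms by (intro cSup_eq_Max) auto
  also have "\<dots> \<in> (\<lambda>k. d k (x k)) ` {t0..T}"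
    using assms by (intro Max_in) auto
  finally show ?thesis using that by blast
qed

lemma sup_term_eqI:
  assumes "k \<in> {t0..T}" "d k (x k) = m" "\<And>j. j \<in> {t0..T} \<Longrightarrow> d j (x j) \<le> m"
  shows "sup_term t0 T d x = m"
  using assms sup_term_upper[of k t0 T d x] by (intro antisym cSUP_least) auto

lemma sup_term_Suc:
  assumes "t0 \<le> T"
  shows "sup_term t0 (Suc T) d x = max (sup_term t0 T d x) (d (Suc T) (x (Suc T)))"
proof -
  have "{t0..Suc T} = insert (Suc T) {t0..T}" using assms by auto
  then show ?thesis
    using assms by (simp add: cSup_insert sup.commute flip: sup_max)
qed

section \<open>Forward separability\<close>

text \<open>
  The carried vector has the cost so far in coordinate \<open>0\<close> and the maximum so far in
  coordinate \<open>1\<close>.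
\<close>

definition cost_max :: "real \<Rightarrow> real \<Rightarrow> nat \<Rightarrow> real" where
  "cost_max s m = (\<lambda>i\<in>{..<2}. if i = 0 then s else m)"

lemma cost_max_in_Rvec: "cost_max s m \<in> Rvec 2"
  by (simp add: cost_max_def Rvec_def)

lemma cost_max_nth [simp]: "cost_max s m 0 = s" "cost_max s m (Suc 0) = m"
  by (simp_all add: cost_max_def)

lemma nested_cost_max:
  "nested (\<lambda>x u. cost_max (c t0 x u) (d t0 x))
      (\<lambda>t x u z. cost_max (z 0 + c t x u) (max (z 1) (d t x))) t0 u x k
    = cost_max (\<Sum>t=t0..<Suc (t0 + k). c t (x t) (u t)) (sup_term t0 (t0 + k) d x)"
  by (induction k) (simp_all add: sup_term_Suc)

lemma forward_separable_sum_plus_sup: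
  fixes c :: "nat \<Rightarrow> real ^ 'n \<Rightarrow> real ^ 'p \<Rightarrow> real"
  assumes "t0 < T"
  shows "forward_separable T t0
    (\<lambda>u x. (\<Sum>t=t0..<T. c t (x t) (u t)) + cT (x T) + sup_term t0 T d x)"
proof -
  define \<phi>0 where "\<phi>0 = (\<lambda>x u. cost_max (c t0 x u) (d t0 x))"
  define \<phi> where
    "\<phi> = (\<lambda>t x u (z :: nat \<Rightarrow> real). cost_max (z 0 + c t x u) (max (z 1) (d t x)))"
  define \<phi>T where "\<phi>T = (\<lambda>x (z :: nat \<Rightarrow> real). z 0 + cT x + max (z 1) (d T x))"
  have "(\<Sum>t=t0..<T. c t (x t) (u t)) + cT (x T) + sup_term t0 T d x
      = \<phi>T (x T) (nested \<phi>0 \<phi> t0 u x (T - 1 - t0))" for u x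
  proof -
    obtain S where T: "T = Suc S" "t0 \<le> S" using assms by (cases T) auto
    then have "t0 + (T - 1 - t0) = S" by simp
    then show ?thesis
      using nested_cost_max[of c t0 d u x "T - 1 - t0"] T
      by (simp add: \<phi>0_def \<phi>_def \<phi>T_def sup_term_Suc)
  qed
  moreover have "\<phi>0 x u \<in> Rvec 2" "\<phi> t x u z \<in> Rvec 2" for t x u z
    by (simp_all add: \<phi>0_def \<phi>_def cost_max_in_Rvec)
  ultimately show ?thesis
    unfolding forward_separable_def
    by (intro exI[of _ 2] exI[of _ \<phi>0] exI[of _ \<phi>] exI[of _ \<phi>T]) blast
qed

section \<open>Feasible sets\<close>

lemma feasible_S_eq_feasible_G:
  assumes "x0 \<in> X"
  shows "feasible_S T X U f t0 x0 = feasible_G T X U f t0 x0"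
proof -
  have "(\<forall>t\<in>{t0..T}. x t \<in> X) \<longleftrightarrow> (\<forall>t\<in>{t0+1..T}. x t \<in> X)" if "x t0 = x0" for x
    using that assms by (metis Suc_eq_plus1 Suc_leD atLeastAtMost_iff not_less_eq_eq order_antisym)
  then show ?thesis
    unfolding feasible_S_def feasible_G_def by blast
qed

lemma feasible_G_nonempty:
  assumes "t0 \<le> T" and nonempty: "\<And>t x. admissible X U f t x \<noteq> {}"
  shows "feasible_G T X U f t0 x0 \<noteq> {}"
proof -
  define g where "g = (\<lambda>t x. SOME u. u \<in> admissible X U f t x)"
  have g: "g t x \<in> admissible X U f t x" for t x
    unfolding g_def using nonempty by (simp add: some_in_eq)
  \<comment> \<open>The trajectory generated by the feedback law \<open>g\<close>, with time counted from \<open>t0\<close>.\<close>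
  define y where "y = rec_nat x0 (\<lambda>k v. f v (g (t0 + k) v) (t0 + k))"
  define x where "x = (\<lambda>t\<in>{t0..T}. y (t - t0))"
  define u where "u = (\<lambda>t\<in>{t0..<T}. g t (y (t - t0)))"
  have step: "y (Suc t - t0) = f (y (t - t0)) (g t (y (t - t0))) t" if "t0 \<le> t" for t
    using that by (simp add: y_def Suc_diff_le)
  have in_X: "y (t - t0) \<in> X" if t: "t \<in> {t0+1..T}" for t
  proof -
    obtain s where "t = Suc s" "t0 \<le> s" using t by (cases t) auto
    then show ?thesis using step g by (auto simp: admissible_def)
  qed
  have "(u, x) \<in> feasible_G T X U f t0 x0"
    using assms(1) step in_X g
    by (auto simp: feasible_G_def controls_def states_def x_def u_def admissible_def y_def)
  then show ?thesis by blast
qed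

lemma problem_S_in_class_G_iff:
  assumes "t0 \<le> T" "\<And>t x. admissible X U f t x \<noteq> {}"
  shows "problem_S T X U f c cT d t0 x0 \<in> class_G T X U f t0 x0 \<longleftrightarrow> x0 \<in> X"
proof
  assume "problem_S T X U f c cT d t0 x0 \<in> class_G T X U f t0 x0"
  then have "feasible_S T X U f t0 x0 \<noteq> {}"
    using feasible_G_nonempty[of t0 T X U f x0] assms by (simp add: problem_S_def class_G_def)
  then show "x0 \<in> X" using assms(1) by (auto simp: feasible_S_def)
qed (simp add: problem_S_def class_G_def feasible_S_eq_feasible_G)

section \<open>When the supremum is a sum\<close>

lemma not_additive_if_genuine_sup:
  fixes d :: "nat \<Rightarrow> real ^ 'n \<Rightarrow> real"
  assumes genuine: "genuine_sup T t0 d"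
    and additive: "\<And>x. x \<in> states T t0 \<Longrightarrow> sup_term t0 T d x = (\<Sum>t=t0..T. h t (x t))"
  shows False
proof -
  obtain x k l y z where x: "x \<in> states T t0" and kl: "k \<in> {t0..T}" "l \<in> {t0..T}" "k \<noteq> l"
    and y: "d k y > sup_term t0 T d x" and z: "d l z > sup_term t0 T d x"
    using genuine unfolding genuine_sup_def by blast
  let ?I = "{t0..T} - {k} - {l}"
  let ?H = "\<lambda>x. \<Sum>t\<in>?I. h t (x t)"
  have le: "d j (x j) \<le> sup_term t0 T d x" if "j \<in> {t0..T}" for j
    using sup_term_upper that .
  have states: "x(k := y) \<in> states T t0" "x(l := z) \<in> states T t0" "x(k := y, l := z) \<in> states T t0"
    using x kl by (auto simp: states_def PiE_def extensional_def)
  have split: "(\<Sum>t=t0..T. h t (w t)) = h k (w k) + (h l (w l) + ?H w)" for w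
    using kl by (simp add: sum.remove[of "{t0..T}" k] sum.remove[of "{t0..T} - {k}" l])
  have cong: "?H (x(k := y)) = ?H x" "?H (x(l := z)) = ?H x" "?H (x(k := y, l := z)) = ?H x"
    by (auto intro!: sum.cong)
  have "sup_term t0 T d (x(k := y)) = d k y"
    using kl y le by (intro sup_term_eqI[of k]) (auto intro: order.trans less_imp_le)
  moreover have "sup_term t0 T d (x(l := z)) = d l z"
    using kl z le by (intro sup_term_eqI[of l]) (auto intro: order.trans less_imp_le)
  moreover have "sup_term t0 T d (x(k := y, l := z)) = max (d k y) (d l z)"
    using kl y z le
    by (intro sup_term_eqI[of "if d k y \<le> d l z then l else k"]) (fastforce simp: max_def)+
  ultimately have "sup_term t0 T d x = min (d k y) (d l z)"
    using additive[OF x] states[THEN additive] kl unfolding split cong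
    by (simp add: max_def min_def split: if_splits)
  then show False using y z by simp
qed

lemma sup_depends_on_one_time:
  fixes d :: "nat \<Rightarrow> real ^ 'n \<Rightarrow> real"
  assumes "t0 \<le> T" and not_genuine: "\<not> genuine_sup T t0 d"
  obtains k h where "k \<in> {t0..T}" "\<And>x. x \<in> states T t0 \<Longrightarrow> sup_term t0 T d x = h (x k)"
proof -
  let ?M = "sup_term t0 T d"
  have at_most_one: "k = l"
    if "x \<in> states T t0" "k \<in> {t0..T}" "l \<in> {t0..T}" "d k y > ?M x" "d l z > ?M x" for x k l y z
    using not_genuine that unfolding genuine_sup_def by blast
  have "\<exists>k\<in>{t0..T}. \<forall>x\<in>states T t0. \<forall>j\<in>{t0..T} - {k}. \<forall>y. d j y \<le> ?M x"
  proof (cases "\<exists>x\<in>states T t0. \<exists>k\<in>{t0..T}. \<exists>y. d k y > ?M x")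
    case True
    then obtain x k y where x: "x \<in> states T t0" and k: "k \<in> {t0..T}" and y: "d k y > ?M x"
      by blast
    have "d j z \<le> ?M x'" if "x' \<in> states T t0" "j \<in> {t0..T} - {k}" for x' j z
    proof (rule ccontr)
      assume "\<not> d j z \<le> ?M x'"
      then have z: "d j z > ?M x'" by simp
      \<comment> \<open>Both \<open>k\<close> and \<open>j\<close> raise the supremum from whichever of \<open>x\<close>, \<open>x'\<close> has the smaller one.\<close>
      show False
      proof (cases "?M x \<le> ?M x'")
        case True
        then show False using at_most_one[OF x k _ y, of j z] z that by auto
      next
        case False
        then show False using at_most_one[OF that(1) k, of j y z] y z that by auto
      qed
    qed
    then show ?thesis using k by blast
  next
    case False
    then show ?thesis using assms(1) by (intro bexI[of _ t0]) (auto simp: not_less)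
  qed
  then obtain k where k: "k \<in> {t0..T}"
    and others: "\<And>x j y. x \<in> states T t0 \<Longrightarrow> j \<in> {t0..T} \<Longrightarrow> j \<noteq> k \<Longrightarrow> d j y \<le> ?M x"
    by blast
  have le: "?M x \<le> ?M x'" if "x \<in> states T t0" "x' \<in> states T t0" "x k = x' k" for x x'
  proof -
    obtain j where "j \<in> {t0..T}" "?M x = d j (x j)" using assms(1) by (rule sup_term_attained)
    then show ?thesis using others[OF that(2)] that(3) sup_term_upper[OF k, of d x'] by metis
  qed
  \<comment> \<open>The state at time \<open>k\<close> decides, so the constant sequence with the same value there will do.\<close>
  have "?M x = ?M (\<lambda>t\<in>{t0..T}. x k)" if "x \<in> states T t0" for x
    using that k by (intro antisym le) (auto simp: states_def)
  with k show ?thesis by (intro that[of k "\<lambda>v. ?M (\<lambda>t\<in>{t0..T}. v)"])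
qed

lemma problem_S_in_class_P_iff:
  assumes "t0 < T" and in_G: "problem_S T X U f c cT d t0 x0 \<in> class_G T X U f t0 x0"
  shows "problem_S T X U f c cT d t0 x0 \<in> class_P T X U f t0 x0 \<longleftrightarrow> \<not> genuine_sup T t0 d"
    (is "?P \<in> _ \<longleftrightarrow> _")
proof
  assume "?P \<in> class_P T X U f t0 x0"
  then obtain c' cT' where eq:
    "(\<Sum>t=t0..<T. c t (x t) (u t)) + cT (x T) + sup_term t0 T d x
        = (\<Sum>t=t0..<T. c' t (x t) (u t)) + cT' (x T)"
    if "u \<in> controls T t0" "x \<in> states T t0" for u x
    unfolding class_P_def problem_S_def by auto
  \<comment> \<open>Fixing any control sequence removes the dependence on the controls.\<close>
  define u :: "nat \<Rightarrow> real ^ 'b" where "u = (\<lambda>t\<in>{t0..<T}. 0)"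
  define h where
    "h = (\<lambda>t v. if t = T then cT' v - cT v else c' t v (u t) - c t v (u t))"
  have "sup_term t0 T d x = (\<Sum>t=t0..T. h t (x t))" if "x \<in> states T t0" for x
  proof -
    have "(\<Sum>t=t0..T. h t (x t)) = (\<Sum>t=t0..<T. h t (x t)) + h T (x T)"
      using assms(1) by (simp add: sum.last_plus)
    also have "(\<Sum>t=t0..<T. h t (x t)) = (\<Sum>t=t0..<T. c' t (x t) (u t) - c t (x t) (u t))"
      by (intro sum.cong) (auto simp: h_def)
    also have "\<dots> + h T (x T) = sup_term t0 T d x"
      using eq[of u x] that by (simp add: h_def u_def controls_def sum_subtractf)
    finally show ?thesis by simp
  qed
  then show "\<not> genuine_sup T t0 d" using not_additive_if_genuine_sup by blast
next
  assume "\<not> genuine_sup T t0 d"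
  then obtain k h where k: "k \<in> {t0..T}"
    and h: "\<And>x. x \<in> states T t0 \<Longrightarrow> sup_term t0 T d x = h (x k)"
    using sup_depends_on_one_time[of t0 T d] assms(1) less_imp_le by metis
  define c' where "c' = (\<lambda>t v w. c t v w + (if t = k then h v else 0))"
  define cT' where "cT' = (\<lambda>v. cT v + (if k = T then h v else 0))"
  have "objective ?P u x = (\<Sum>t=t0..<T. c' t (x t) (u t)) + cT' (x T)"
    if "x \<in> states T t0" for u x
    using k h[OF that]
    by (simp add: problem_S_def c'_def cT'_def sum.distrib sum.delta)
  then show "?P \<in> class_P T X U f t0 x0"
    using in_G unfolding class_P_def by blast
qed

section \<open>The problem \<open>S\<close> as a forward separable problem\<close>

theorem corollary2:
  fixes T t0 :: nat
    and X :: "(real ^ 'n) set" and U :: "(real ^ 'p) set"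
    and f :: "real ^ 'n \<Rightarrow> real ^ 'p \<Rightarrow> nat \<Rightarrow> real ^ 'n"
    and c :: "nat \<Rightarrow> real ^ 'n \<Rightarrow> real ^ 'p \<Rightarrow> real"
    and cT :: "real ^ 'n \<Rightarrow> real"
    and d :: "nat \<Rightarrow> real ^ 'n \<Rightarrow> real"
    and x0 :: "real ^ 'n"
  assumes "t0 < T"
    and "\<And>t x. admissible X U f t x \<noteq> {}"
  shows "forward_separable T t0 (objective (problem_S T X U f c cT d t0 x0)) \<and>
    (x0 \<in> X \<longrightarrow> problem_S T X U f c cT d t0 x0 \<in> class_G T X U f t0 x0) \<and>
    (problem_S T X U f c cT d t0 x0 \<in> class_H T X U f t0 x0 \<longleftrightarrow> x0 \<in> X \<and> genuine_sup T t0 d)"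
proof -
  let ?P = "problem_S T X U f c cT d t0 x0"
  have "forward_separable T t0 (objective ?P)"
    using forward_separable_sum_plus_sup[OF assms(1)] by (simp add: problem_S_def)
  moreover have "?P \<in> class_G T X U f t0 x0 \<longleftrightarrow> x0 \<in> X"
    using problem_S_in_class_G_iff assms by (metis less_imp_le)
  moreover have "?P \<in> class_P T X U f t0 x0 \<longleftrightarrow> \<not> genuine_sup T t0 d"
    if "?P \<in> class_G T X U f t0 x0"
    using problem_S_in_class_P_iff[OF assms(1) that] .
  ultimately show ?thesis
    unfolding class_H_def by blast
qed

end
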